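(* Let $\lambda,\mu$ be positive integers with $\mu\mid(\lambda+2)$, and let $\overline{\Gamma}$ be the graph obtained from any construction data with parameters $(\lambda,\mu)$ as defined in the context, with underlying graphs $\Gamma_1,\Gamma_2,\Gamma_3$. Then: (i) $\overline{\Gamma}$ has $3\mu\lambda(\lambda+2)$ vertices. (ii) Every vertex of $\overline{\Gamma}$ is adjacent to exactly $(3\mu+1)\lambda$ other vertices. (iii) Every two adjacent vertices of $\overline{\Gamma}$ have exactly $\lambda$ common neighbours. (iv) If $\Gamma_i$ for some $i\in\{1,2,3\}$ contains a clique $C$ of size $\lambda+2$, then in $\overline{\Gamma}$, $C$ is a regular clique of size $\lambda+2$ and nexus $1$, so that $\overline{\Gamma}$ is a Neumaier graph with parameters $(3\mu\lambda(\lambda+2),(3\mu+1)\lambda,\lambda;1,\lambda+2)$.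
   Context: Graphs are finite, simple and undirected. For $k\ge 1$, a $k$-regular graph on $v\ge 2$ vertices is edge-regular with parameters $(v,k,\lambda)$ if any two adjacent vertices have exactly $\lambda$ common neighbours. A nonempty clique $C$ of a regular graph is regular with nexus $e$ if every vertex outside $C$ is adjacent to exactly $e$ vertices of $C$. A Neumaier graph with parameters $(v,k,\lambda;e,s)$ is an edge-regular graph with parameters $(v,k,\lambda)$ having a regular clique of size $s$ and nexus $e$. Construction data with parameters $(\lambda,\mu)$. Put $n:=\mu\lambda(\lambda+2)$, $k:=\lambda(\mu+1)$, $\nu:=(\lambda+2)/\mu$. The data consist of the following. - Three vertex-disjoint edge-regular graphs $\Gamma_i=(V_i,E_i)$, $i\in\{1,2,3\}$, each with parameters $(n,k,\lambda)$. - For each $i$, a partition $\Omega_i$ of $V_i$ into $\nu$ sets of size $\mu^2\lambda$, and two partitions $\mathcal{P}_i,\mathcal{P}_i'$ of $V_i$ into $\mu\nu$ independent sets of $\Gamma_i$ of size $\mu\lambda$, such that every element of $\Omega_i$ is the union of $\mu$ elements of $\mathcal{P}_i$ and also the union of $\mu$ elements of $\mathcal{P}_i'$, and such that whenever $\omega\in\Omega_i$, $P\in\mathcal{P}_i$, $P'\in\mathcal{P}_i'$ satisfy $P,P'\subseteq\omega$, then $|P\cap P'|=\lambda$. - Three admissible bijections $\varphi_{12}:\mathcal{P}_1\to\mathcal{P}_2'$, $\varphi_{23}:\mathcal{P}_2\to\mathcal{P}_3'$, $\varphi_{31}:\mathcal{P}_3\to\mathcal{P}_1'$. Here a bijection $\varphi:\mathcal{P}_i\to\mathcal{P}_j'$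 ($i\ne j$) is admissible if for every $\omega=P_1\cup\dots\cup P_\mu\in\Omega_i$ with $P_1,\dots,P_\mu\in\mathcal{P}_i$, the set $\omega^\varphi:=P_1^\varphi\cup\dots\cup P_\mu^\varphi$ belongs to $\Omega_j$; so $\varphi$ induces a map $\Omega_i\to\Omega_j$. It is required that the composition of the induced maps $\Omega_1\to\Omega_2\to\Omega_3\to\Omega_1$ (of $\varphi_{12}$, then $\varphi_{23}$, then $\varphi_{31}$) is the identity on $\Omega_1$. The graph $\overline{\Gamma}$ has vertex set $V_1\cup V_2\cup V_3$. Two vertices of the same $V_i$ are adjacent in $\overline{\Gamma}$ iff they are adjacent in $\Gamma_i$. For $(i,j)\in\{(1,2),(2,3),(3,1)\}$, a vertex $v\in V_i$ and a vertex $w\in V_j$ are adjacent iff $w\in\varphi_{ij}(P)$, where $P$ is the unique element of $\mathcal{P}_i$ containing $v$. *)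

theory Defs
  imports "Graph_Theory.Pair_Digraph" "HOL-Library.Disjoint_Sets"
begin

text \<open>
  A finite simple undirected graph is a \<^term>\<open>pair_graph\<close>: finite, loopless, and every
  edge \<open>uv\<close> is represented by the two arcs \<open>(u, v)\<close> and \<open>(v, u)\<close>.
\<close>

definition neighbours :: "'a pair_pre_digraph \<Rightarrow> 'a \<Rightarrow> 'a set" where
  "neighbours G v = {w \<in> pverts G. (v, w) \<in> parcs G}"

definition regular_graph :: "'a pair_pre_digraph \<Rightarrow> nat \<Rightarrow> bool" where
  "regular_graph G k \<longleftrightarrow> pair_graph G \<and> (\<forall>v\<in>pverts G. card (neighbours G v) = k)"

definition edge_regular :: "'a pair_pre_digraph \<Rightarrow> nat \<Rightarrow> nat \<Rightarrow> nat \<Rightarrow> bool" where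
  "edge_regular G v k lam \<longleftrightarrow>
     regular_graph G k \<and> k \<ge> 1 \<and> card (pverts G) = v \<and> v \<ge> 2 \<and>
     (\<forall>(x, y)\<in>parcs G. card (neighbours G x \<inter> neighbours G y) = lam)"

definition clique :: "'a pair_pre_digraph \<Rightarrow> 'a set \<Rightarrow> bool" where
  "clique G C \<longleftrightarrow> C \<subseteq> pverts G \<and> (\<forall>u\<in>C. \<forall>v\<in>C. u \<noteq> v \<longrightarrow> (u, v) \<in> parcs G)"

definition independent_set :: "'a pair_pre_digraph \<Rightarrow> 'a set \<Rightarrow> bool" where
  "independent_set G S \<longleftrightarrow> S \<subseteq> pverts G \<and> (\<forall>u\<in>S. \<forall>v\<in>S. (u, v) \<notin> parcs G)"

definition regular_clique :: "'a pair_pre_digraph \<Rightarrow> 'a set \<Rightarrow> nat \<Rightarrow> bool" where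
  "regular_clique G C e \<longleftrightarrow>
     (\<exists>k. regular_graph G k) \<and> clique G C \<and> C \<noteq> {} \<and>
     (\<forall>v\<in>pverts G - C. card (neighbours G v \<inter> C) = e)"

definition neumaier_graph ::
  "'a pair_pre_digraph \<Rightarrow> nat \<Rightarrow> nat \<Rightarrow> nat \<Rightarrow> nat \<Rightarrow> nat \<Rightarrow> bool" where
  "neumaier_graph G v k lam e s \<longleftrightarrow>
     edge_regular G v k lam \<and> (\<exists>C. regular_clique G C e \<and> card C = s)"

definition partition_into :: "'a set \<Rightarrow> nat \<Rightarrow> nat \<Rightarrow> 'a set set \<Rightarrow> bool" where
  "partition_into A m s Q \<longleftrightarrow> partition_on A Q \<and> card Q = m \<and> (\<forall>X\<in>Q. card X = s)"

text \<open>
  In the following two definitions \<open>P\<close>, \<open>Om\<close> belong to the source graph and \<open>P'\<close>, \<open>Om'\<close> to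
  the target graph.  The value \<open>induced_map P \<phi> \<omega>\<close> is the set written \<open>\<omega>\<^sup>\<phi>\<close>, where \<open>\<omega>\<close> is a
  union of members of the partition \<open>P\<close>: these members are exactly the ones contained in \<open>\<omega>\<close>.
\<close>

definition admissible ::
  "nat \<Rightarrow> 'a set set \<Rightarrow> 'a set set \<Rightarrow> 'a set set \<Rightarrow> 'a set set \<Rightarrow> ('a set \<Rightarrow> 'a set) \<Rightarrow> bool" where
  "admissible mu Om P Om' P' \<phi> \<longleftrightarrow>
     bij_betw \<phi> P P' \<and>
     (\<forall>S\<subseteq>P. card S = mu \<and> \<Union>S \<in> Om \<longrightarrow> \<Union>(\<phi> ` S) \<in> Om')"

definition induced_map :: "'a set set \<Rightarrow> ('a set \<Rightarrow> 'a set) \<Rightarrow> 'a set \<Rightarrow> 'a set" where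
  "induced_map P \<phi> \<omega> = \<Union>(\<phi> ` {X \<in> P. X \<subseteq> \<omega>})"

text \<open>
  The families \<open>\<Gamma>\<close>, \<open>Om\<close>, \<open>P\<close>, \<open>P'\<close> are used at the indices 1, 2, 3 only.
\<close>

locale construction_data =
  fixes lam mu :: nat
    and \<Gamma> :: "nat \<Rightarrow> 'a pair_pre_digraph"
    and Om P P' :: "nat \<Rightarrow> 'a set set"
    and \<phi>12 \<phi>23 \<phi>31 :: "'a set \<Rightarrow> 'a set"
  assumes disjoint_graphs: "disjoint_family_on (\<lambda>i. pverts (\<Gamma> i)) {1, 2, 3}"
    and edge_regular:
      "i \<in> {1, 2, 3} \<Longrightarrow>
         edge_regular (\<Gamma> i) (mu * lam * (lam + 2)) (lam * (mu + 1)) lam"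
    and partition_Om:
      "i \<in> {1, 2, 3} \<Longrightarrow>
         partition_into (pverts (\<Gamma> i)) ((lam + 2) div mu) (mu\<^sup>2 * lam) (Om i)"
    and partition_P:
      "i \<in> {1, 2, 3} \<Longrightarrow>
         partition_into (pverts (\<Gamma> i)) (mu * ((lam + 2) div mu)) (mu * lam) (P i)"
    and partition_P':
      "i \<in> {1, 2, 3} \<Longrightarrow>
         partition_into (pverts (\<Gamma> i)) (mu * ((lam + 2) div mu)) (mu * lam) (P' i)"
    and independent_P: "\<lbrakk>i \<in> {1, 2, 3}; X \<in> P i\<rbrakk> \<Longrightarrow> independent_set (\<Gamma> i) X"
    and independent_P': "\<lbrakk>i \<in> {1, 2, 3}; X \<in> P' i\<rbrakk> \<Longrightarrow> independent_set (\<Gamma> i) X"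
    and union_P:
      "\<lbrakk>i \<in> {1, 2, 3}; \<omega> \<in> Om i\<rbrakk> \<Longrightarrow> \<exists>S\<subseteq>P i. card S = mu \<and> \<omega> = \<Union>S"
    and union_P':
      "\<lbrakk>i \<in> {1, 2, 3}; \<omega> \<in> Om i\<rbrakk> \<Longrightarrow> \<exists>S\<subseteq>P' i. card S = mu \<and> \<omega> = \<Union>S"
    and card_inter:
      "\<lbrakk>i \<in> {1, 2, 3}; \<omega> \<in> Om i; X \<in> P i; X' \<in> P' i; X \<subseteq> \<omega>; X' \<subseteq> \<omega>\<rbrakk>
         \<Longrightarrow> card (X \<inter> X') = lam"
    and admissible_12: "admissible mu (Om 1) (P 1) (Om 2) (P' 2) \<phi>12"
    and admissible_23: "admissible mu (Om 2) (P 2) (Om 3) (P' 3) \<phi>23"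
    and admissible_31: "admissible mu (Om 3) (P 3) (Om 1) (P' 1) \<phi>31"
    and induced_identity:
      "\<omega> \<in> Om 1 \<Longrightarrow>
         induced_map (P 3) \<phi>31 (induced_map (P 2) \<phi>23 (induced_map (P 1) \<phi>12 \<omega>)) = \<omega>"

definition part_of :: "'a set set \<Rightarrow> 'a \<Rightarrow> 'a set" where
  "part_of Q v = (THE X. X \<in> Q \<and> v \<in> X)"

definition cross_arcs ::
  "'a pair_pre_digraph \<Rightarrow> 'a set set \<Rightarrow> 'a pair_pre_digraph \<Rightarrow> ('a set \<Rightarrow> 'a set) \<Rightarrow> 'a rel" where
  "cross_arcs G P H \<phi> = {(v, w). v \<in> pverts G \<and> w \<in> pverts H \<and> w \<in> \<phi> (part_of P v)}"

definition Gamma_bar ::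
  "(nat \<Rightarrow> 'a pair_pre_digraph) \<Rightarrow> (nat \<Rightarrow> 'a set set) \<Rightarrow>
   ('a set \<Rightarrow> 'a set) \<Rightarrow> ('a set \<Rightarrow> 'a set) \<Rightarrow> ('a set \<Rightarrow> 'a set) \<Rightarrow> 'a pair_pre_digraph" where
  "Gamma_bar \<Gamma> P \<phi>12 \<phi>23 \<phi>31 =
     (let A = cross_arcs (\<Gamma> 1) (P 1) (\<Gamma> 2) \<phi>12 \<union> cross_arcs (\<Gamma> 2) (P 2) (\<Gamma> 3) \<phi>23 \<union>
              cross_arcs (\<Gamma> 3) (P 3) (\<Gamma> 1) \<phi>31
      in \<lparr> pverts = (\<Union>i\<in>{1, 2, 3}. pverts (\<Gamma> i)),
           parcs = (\<Union>i\<in>{1, 2, 3}. parcs (\<Gamma> i)) \<union> A \<union> A\<inverse> \<rparr>)"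

lemma (in construction_data) pair_graph_Gamma_bar:
  "pair_graph (Gamma_bar \<Gamma> P \<phi>12 \<phi>23 \<phi>31)"
proof -
  let ?G = "Gamma_bar \<Gamma> P \<phi>12 \<phi>23 \<phi>31"
  have gr: "pair_graph (\<Gamma> i)" if "i \<in> {1, 2, 3}" for i
    using edge_regular[OF that] by (simp add: edge_regular_def regular_graph_def)
  interpret G1: pair_graph "\<Gamma> 1" by (rule gr) simp
  interpret G2: pair_graph "\<Gamma> 2" by (rule gr) simp
  interpret G3: pair_graph "\<Gamma> 3" by (rule gr) simp
  have disj: "pverts (\<Gamma> 1) \<inter> pverts (\<Gamma> 2) = {}" "pverts (\<Gamma> 2) \<inter> pverts (\<Gamma> 3) = {}"
    "pverts (\<Gamma> 3) \<inter> pverts (\<Gamma> 1) = {}"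
    using disjoint_graphs by (auto simp: disjoint_family_on_def)
  have wf: "fst e \<in> pverts ?G \<and> snd e \<in> pverts ?G" if "e \<in> parcs ?G" for e
    using that G1.wellformed' G2.wellformed' G3.wellformed'
    by (cases e) (auto simp: Gamma_bar_def Let_def cross_arcs_def)
  have fv: "finite (pverts ?G)"
    using G1.pair_finite_verts G2.pair_finite_verts G3.pair_finite_verts
    by (simp add: Gamma_bar_def Let_def)
  have "parcs ?G \<subseteq> pverts ?G \<times> pverts ?G"
    using wf by (metis mem_Times_iff subsetI)
  then have fa: "finite (parcs ?G)"
    using fv by (meson finite_SigmaI finite_subset)
  have sy: "(v, u) \<in> parcs ?G" if "(u, v) \<in> parcs ?G" for u v
    using that G1.arcs_symmetric G2.arcs_symmetric G3.arcs_symmetric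
    by (auto simp: Gamma_bar_def Let_def)
  have nl: "(b, b) \<notin> parcs (\<Gamma> 1)" "(b, b) \<notin> parcs (\<Gamma> 2)" "(b, b) \<notin> parcs (\<Gamma> 3)" for b
    using G1.no_loops' G2.no_loops' G3.no_loops' by blast+
  have lf: "fst e \<noteq> snd e" if "e \<in> parcs ?G" for e
    using that disj nl
    by (cases e) (auto simp: Gamma_bar_def Let_def cross_arcs_def)
  show ?thesis
    using wf fv fa sy lf by unfold_locales (auto simp: symmetric_def intro: symI)
qed

end

theory Submission
  imports Defs
begin

text \<open>
  The gluing joins each cell of \<open>P i\<close> completely to one cell of \<open>P' j\<close>, where \<open>j\<close> is the successor
  of \<open>i\<close> in the cyclic order 1, 2, 3. Hence the neighbourhood of a vertex \<open>x\<close> in \<open>V\<^sub>1\<close> consists of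
  its old neighbourhood, one cell of \<open>P' 2\<close> (the image of the \<open>P 1\<close>-cell of \<open>x\<close>), and one cell of
  \<open>P 3\<close> (the preimage of the \<open>P' 1\<close>-cell of \<open>x\<close>). This is \<open>neighbours_V1\<close>; it gives the degree
  \<open>\<lambda>(\<mu> + 1) + 2 \<mu> \<lambda>\<close>.

  For two adjacent vertices of the same \<open>V\<^sub>i\<close>, nothing is added to their \<open>\<lambda>\<close> old common neighbours:
  cells are independent, so the two vertices lie in different cells of either partition, and their
  images and preimages are different, hence disjoint, cells. For an edge \<open>xy\<close> from \<open>V\<^sub>1\<close> to \<open>V\<^sub>2\<close>,
  independence of the cells excludes common neighbours in \<open>V\<^sub>1\<close> and \<open>V\<^sub>2\<close>. Those in \<open>V\<^sub>3\<close> form the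
  intersection of a cell of \<open>P' 3\<close> (image of the \<open>P 2\<close>-cell of \<open>y\<close>) with a cell of \<open>P 3\<close> (preimage
  of the \<open>P' 1\<close>-cell of \<open>x\<close>). Following the block of \<open>Om 1\<close> that contains \<open>x\<close> once around the triangle
  shows, because the composition of the induced maps is the identity, that both cells lie in one
  block of \<open>Om 3\<close>; so they meet in \<open>\<lambda>\<close> points (\<open>common_neighbours_across_12\<close>).

  A clique \<open>C\<close> with \<open>\<lambda> + 2\<close> vertices in \<open>V\<^sub>1\<close> has as many vertices as \<open>P 1\<close> and \<open>P' 1\<close> have cells,
  so it meets each of these independent cells exactly once (\<open>clique_transversal\<close>); this is the
  nexus 1 for vertices of \<open>V\<^sub>2\<close> and \<open>V\<^sub>3\<close>. For the vertices of \<open>V\<^sub>1\<close> outside \<open>C\<close>, nexus 1 is a count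
  inside \<open>\<Gamma> 1\<close> (\<open>clique_nexus_one\<close>).

  The hypotheses are invariant under the rotation 1, 2, 3 \<open>\<mapsto>\<close> 2, 3, 1 (\<open>rotate\<close>), so each argument is
  carried out for one position only and transported to the other two.
\<close>

section \<open>Cells of a partition\<close>

lemma cells_eqI:
  assumes "partition_on A Q" "X \<in> Q" "Y \<in> Q" "v \<in> X" "v \<in> Y"
  shows "X = Y"
  using assms partition_onD2[OF assms(1)] by (auto dest: disjointD)

lemma part_of_eqI:
  assumes "partition_on A Q" "X \<in> Q" "v \<in> X"
  shows "part_of Q v = X"
  unfolding part_of_def using assms cells_eqI[OF assms(1)] by (intro the_equality) blast+

lemma part_of_mem:
  assumes "partition_on A Q" "v \<in> A"
  shows "part_of Q v \<in> Q" "v \<in> part_of Q v"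
proof -
  obtain X where "X \<in> Q" "v \<in> X"
    using assms by (auto simp: partition_on_def)
  with part_of_eqI[OF assms(1)] show "part_of Q v \<in> Q" "v \<in> part_of Q v" by auto
qed

lemma cells_within_Union:
  assumes "partition_on A Q" "S \<subseteq> Q"
  shows "{X \<in> Q. X \<subseteq> \<Union>S} = S"
proof
  show "{X \<in> Q. X \<subseteq> \<Union>S} \<subseteq> S"
  proof
    fix X assume X: "X \<in> {X \<in> Q. X \<subseteq> \<Union>S}"
    then obtain v where v: "v \<in> X" using partition_onD3[OF assms(1)] by fastforce
    with X obtain Y where "Y \<in> S" "v \<in> Y" by auto
    with X v assms show "X \<in> S" by (metis (lifting) mem_Collect_eq part_of_eqI subsetD)
  qed
qed (use assms in auto)

lemma cell_subset_union_of_cells: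
  assumes "partition_on A Q" "\<exists>S\<subseteq>Q. card S = m \<and> \<omega> = \<Union>S" "X \<in> Q" "x \<in> X" "x \<in> \<omega>"
  shows "X \<subseteq> \<omega>"
proof -
  obtain S where S: "S \<subseteq> Q" "\<omega> = \<Union>S" using assms(2) by blast
  with assms(5) obtain Y where "Y \<in> S" "x \<in> Y" by blast
  with S cells_eqI[OF assms(1,3) _ assms(4)] show ?thesis by auto
qed

text \<open>
  A union of target cells determines these cells, and \<open>\<phi>\<close> is injective, so containment of cells can
  be followed through an induced map in both directions. The backward direction is what closes the
  circle around the triangle.
\<close>

lemma image_cell_subset_induced_map_iff:
  assumes "partition_on B Q'" "bij_betw \<phi> Q Q'" "X \<in> Q"
  shows "\<phi> X \<subseteq> induced_map Q \<phi> \<omega> \<longleftrightarrow> X \<subseteq> \<omega>"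
proof -
  let ?S = "{X \<in> Q. X \<subseteq> \<omega>}"
  have "{Y \<in> Q'. Y \<subseteq> \<Union>(\<phi> ` ?S)} = \<phi> ` ?S"
    using assms by (intro cells_within_Union) (auto simp: bij_betw_def)
  moreover have "\<phi> X \<in> Q'" using assms by (auto simp: bij_betw_def)
  ultimately have "\<phi> X \<subseteq> induced_map Q \<phi> \<omega> \<longleftrightarrow> \<phi> X \<in> \<phi> ` ?S"
    unfolding induced_map_def by blast
  also have "\<dots> \<longleftrightarrow> X \<in> ?S"
    using assms by (intro inj_on_image_mem_iff[where B = Q]) (auto simp: bij_betw_def)
  finally show ?thesis using assms by simp
qed

text \<open>
  Admissibility speaks of families of \<open>m\<close> cells, the induced map of the cells contained in
  \<open>\<omega>\<close>; for a block \<open>\<omega>\<close> these are the same family.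
\<close>

lemma induced_map_mem:
  assumes "partition_on A Q" "admissible m Om Q Om' Q' \<phi>" "\<omega> \<in> Om"
    and "\<exists>S\<subseteq>Q. card S = m \<and> \<omega> = \<Union>S"
  shows "induced_map Q \<phi> \<omega> \<in> Om'"
proof -
  obtain S where S: "S \<subseteq> Q" "card S = m" "\<omega> = \<Union>S" using assms by blast
  have "{X \<in> Q. X \<subseteq> \<omega>} = S" using cells_within_Union[OF assms(1) S(1)] S(3) by simp
  with S assms show ?thesis by (auto simp: induced_map_def admissible_def)
qed

text \<open>
  The cross edges at a vertex \<open>w\<close> of the target graph, seen from \<open>w\<close>: they lead to one whole cell of
  the source partition.
\<close>

lemma mem_image_part_of_iff:
  assumes "partition_on A Q" "partition_on B Q'" "bij_betw \<phi> Q Q'" "w \<in> B"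
  shows "v \<in> A \<and> w \<in> \<phi> (part_of Q v) \<longleftrightarrow> v \<in> inv_into Q \<phi> (part_of Q' w)"
proof
  assume *: "v \<in> A \<and> w \<in> \<phi> (part_of Q v)"
  have "part_of Q v \<in> Q" "v \<in> part_of Q v" using part_of_mem[OF assms(1)] * by auto
  moreover from this * have "part_of Q' w = \<phi> (part_of Q v)"
    using assms by (intro part_of_eqI) (auto simp: bij_betw_def)
  ultimately show "v \<in> inv_into Q \<phi> (part_of Q' w)"
    using assms by (simp add: bij_betw_def)
next
  let ?X = "inv_into Q \<phi> (part_of Q' w)"
  assume *: "v \<in> ?X"
  have w: "part_of Q' w \<in> Q'" "w \<in> part_of Q' w" using part_of_mem[OF assms(2,4)] by auto
  then have X: "?X \<in> Q" "\<phi> ?X = part_of Q' w"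
    using assms(3) by (auto simp: bij_betw_def inv_into_into f_inv_into_f)
  have "part_of Q v = ?X" by (rule part_of_eqI[OF assms(1) X(1) *])
  with X w * assms(1) show "v \<in> A \<and> w \<in> \<phi> (part_of Q v)"
    by (auto simp: partition_on_def)
qed

section \<open>Cliques that are as large as possible\<close>

text \<open>
  A clique meets an independent set at most once, so sending a vertex to its cell is injective on
  \<open>C\<close>; as \<open>C\<close> and \<open>Q\<close> are equally large, it is also onto.
\<close>

lemma clique_transversal:
  assumes part: "partition_on (pverts H) Q" and fin: "finite Q"
    and ind: "\<And>X. X \<in> Q \<Longrightarrow> independent_set H X"
    and C: "clique H C" "card C = card Q" and X: "X \<in> Q"
  shows "card (X \<inter> C) = 1"
proof -
  have CV: "C \<subseteq> pverts H" using C by (simp add: clique_def)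
  have mem: "part_of Q u \<in> Q" "u \<in> part_of Q u" if "u \<in> C" for u
    using part_of_mem[OF part] that CV by auto
  have inj: "inj_on (part_of Q) C"
  proof (rule inj_onI, rule ccontr)
    fix u v assume uv: "u \<in> C" "v \<in> C" "part_of Q u = part_of Q v" "u \<noteq> v"
    then have "(u, v) \<in> parcs H" using C by (simp add: clique_def)
    moreover have "(u, v) \<notin> parcs H"
      using ind[OF mem(1)[OF uv(1)]] mem(2)[OF uv(1)] mem(2)[OF uv(2)] uv(3)
      by (simp add: independent_set_def)
    ultimately show False by simp
  qed
  have "part_of Q ` C = Q"
    using mem inj C fin by (intro card_subset_eq) (auto simp: card_image)
  then obtain u where u: "u \<in> C" "part_of Q u = X" using X by (metis imageE)
  have "X \<inter> C = {u}"
  proof (intro equalityI subsetI)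
    fix v assume "v \<in> X \<inter> C"
    then show "v \<in> {u}" using part_of_eqI[OF part X] u inj_onD[OF inj] by blast
  qed (use u mem in auto)
  then show ?thesis by simp
qed

text \<open>
  Two vertices of \<open>C\<close> already have the other \<open>l\<close> vertices of \<open>C\<close> as common neighbours, so no vertex
  outside \<open>C\<close> is adjacent to both. Hence the sets of outer neighbours of the vertices of \<open>C\<close>, each
  with \<open>k - (l + 1)\<close> elements, are disjoint; the assumption on \<open>n\<close> says precisely that together they
  have as many elements as the complement of \<open>C\<close>, so they partition it.
\<close>

lemma clique_nexus_one:
  assumes er: "edge_regular H n k l" and n: "n = (l + 2) * (k - l)"
    and C: "clique H C" "card C = l + 2" and w: "w \<in> pverts H - C"
  shows "card (neighbours H w \<inter> C) = 1"
proof -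
  interpret pair_graph H using er by (simp add: edge_regular_def regular_graph_def)
  have CV: "C \<subseteq> pverts H" using C by (simp add: clique_def)
  have finV: "finite (pverts H)" by (rule pair_finite_verts)
  have finC: "finite C" using CV finV finite_subset by blast
  have finN: "finite (neighbours H u)" for u using finV by (simp add: neighbours_def)
  have adj: "v \<in> neighbours H u" if "u \<in> C" "v \<in> C" "u \<noteq> v" for u v
    using that C CV by (auto simp: clique_def neighbours_def)
  have irr: "u \<notin> neighbours H u" for u
    using no_loops' by (auto simp: neighbours_def)
  let ?N = "\<lambda>u. neighbours H u - C"
  have disj: "?N u \<inter> ?N v = {}" if uv: "u \<in> C" "v \<in> C" "u \<noteq> v" for u v
  proof -
    have "(u, v) \<in> parcs H" using uv C by (simp add: clique_def)
    then have "card (neighbours H u \<inter> neighbours H v) = l"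
      using er by (auto simp: edge_regular_def)
    moreover have "card (C - {u, v}) = l" using uv C finC by (simp add: card_Diff_subset)
    moreover have "C - {u, v} \<subseteq> neighbours H u \<inter> neighbours H v" using uv adj by auto
    ultimately have "C - {u, v} = neighbours H u \<inter> neighbours H v"
      using finN by (intro card_subset_eq) auto
    then show ?thesis by auto
  qed
  have cardN: "card (?N u) = k - (l + 1)" and kl: "l + 1 \<le> k" if u: "u \<in> C" for u
  proof -
    have 1: "neighbours H u \<inter> C = C - {u}" using adj[OF u] irr by auto
    have 2: "card (C - {u}) = l + 1" using u C finC by simp
    have 3: "card (neighbours H u) = k"
      using er u CV by (auto simp: edge_regular_def regular_graph_def)
    show "card (?N u) = k - (l + 1)"
      using card_Diff_subset_Int[of "neighbours H u" C] finC 1 2 3 by simp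
    show "l + 1 \<le> k"
      using card_mono[OF finN, of "C - {u}" u] 1 2 3 by (metis inf_le1)
  qed
  have "C \<noteq> {}" using C by auto
  with kl have kl: "l + 1 \<le> k" by blast
  have "card (\<Union>u\<in>C. ?N u) = (\<Sum>u\<in>C. card (?N u))"
    using finC finN disj by (intro card_UN_disjoint) auto
  also have "\<dots> = (l + 2) * (k - (l + 1))" using cardN C by simp
  also have "\<dots> = card (pverts H - C)"
  proof -
    have "(l + 2) * (k - l) - (l + 2) = (l + 2) * (k - (l + 1))"
      using kl by (simp add: diff_mult_distrib2)
    then show ?thesis
      using card_Diff_subset[OF finC CV] C n er by (simp add: edge_regular_def)
  qed
  finally have "(\<Union>u\<in>C. ?N u) = pverts H - C"
    using finV by (intro card_subset_eq) (auto simp: neighbours_def)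
  then obtain u where u: "u \<in> C" "w \<in> ?N u" using w by auto
  have sym: "w \<in> neighbours H v \<longleftrightarrow> v \<in> neighbours H w" if "v \<in> C" for v
    using that w CV arcs_symmetric by (auto simp: neighbours_def)
  have "neighbours H w \<inter> C = {u}"
    using u disj sym by blast
  then show ?thesis by simp
qed

section \<open>Cyclic symmetry of the construction\<close>

definition rot :: "nat \<Rightarrow> nat" where
  "rot i = (if i = 1 then 2 else if i = 2 then 3 else 1)"

lemma rot_simps: "rot 1 = 2" "rot 2 = 3" "rot 3 = 1"
  by (simp_all add: rot_def)

lemma rot_mem: "i \<in> {1, 2, 3} \<Longrightarrow> rot i \<in> {1, 2, 3}"
  by (auto simp: rot_def)

context construction_data
begin

abbreviation \<Gamma>bar :: "'a pair_pre_digraph" where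
  "\<Gamma>bar \<equiv> Gamma_bar \<Gamma> P \<phi>12 \<phi>23 \<phi>31"

lemma partition_on_Om: "i \<in> {1, 2, 3} \<Longrightarrow> partition_on (pverts (\<Gamma> i)) (Om i)"
  and partition_on_P: "i \<in> {1, 2, 3} \<Longrightarrow> partition_on (pverts (\<Gamma> i)) (P i)"
  and partition_on_P': "i \<in> {1, 2, 3} \<Longrightarrow> partition_on (pverts (\<Gamma> i)) (P' i)"
  using partition_Om partition_P partition_P' by (auto simp: partition_into_def)

lemma pair_graph_\<Gamma>: "i \<in> {1, 2, 3} \<Longrightarrow> pair_graph (\<Gamma> i)"
  using edge_regular by (simp add: edge_regular_def regular_graph_def)

lemma finite_verts: "i \<in> {1, 2, 3} \<Longrightarrow> finite (pverts (\<Gamma> i))"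
proof -
  assume "i \<in> {1, 2, 3}"
  then interpret pair_graph "\<Gamma> i" by (rule pair_graph_\<Gamma>)
  show ?thesis by (rule pair_finite_verts)
qed

lemma disjoint_verts: "pverts (\<Gamma> 1) \<inter> pverts (\<Gamma> 2) = {}" "pverts (\<Gamma> 2) \<inter> pverts (\<Gamma> 3) = {}"
    "pverts (\<Gamma> 3) \<inter> pverts (\<Gamma> 1) = {}"
  using disjoint_graphs by (auto simp: disjoint_family_on_def)

lemma bij_\<phi>: "bij_betw \<phi>12 (P 1) (P' 2)" "bij_betw \<phi>23 (P 2) (P' 3)" "bij_betw \<phi>31 (P 3) (P' 1)"
  using admissible_12 admissible_23 admissible_31 by (simp_all add: admissible_def)

lemma induced_mem:
  shows "\<omega> \<in> Om 1 \<Longrightarrow> induced_map (P 1) \<phi>12 \<omega> \<in> Om 2"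
    and "\<omega> \<in> Om 2 \<Longrightarrow> induced_map (P 2) \<phi>23 \<omega> \<in> Om 3"
    and "\<omega> \<in> Om 3 \<Longrightarrow> induced_map (P 3) \<phi>31 \<omega> \<in> Om 1"
  using induced_map_mem[OF partition_on_P admissible_12 _ union_P]
    induced_map_mem[OF partition_on_P admissible_23 _ union_P]
    induced_map_mem[OF partition_on_P admissible_31 _ union_P] by blast+

text \<open>
  Writing \<open>f\<^sub>1\<^sub>2\<close>, \<open>f\<^sub>2\<^sub>3\<close>, \<open>f\<^sub>3\<^sub>1\<close> for the induced maps, \<open>f\<^sub>1\<^sub>2\<close> has a left inverse and is thus a bijection
  between the equally large finite sets \<open>Om 1\<close> and \<open>Om 2\<close>. So every block of \<open>Om 2\<close> is \<open>f\<^sub>1\<^sub>2 \<omega>\<close> for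
  some \<open>\<omega>\<close>, and \<open>f\<^sub>1\<^sub>2 (f\<^sub>3\<^sub>1 (f\<^sub>2\<^sub>3 (f\<^sub>1\<^sub>2 \<omega>))) = f\<^sub>1\<^sub>2 \<omega>\<close>.
\<close>

lemma induced_identity_rotated:
  assumes "\<omega> \<in> Om 2"
  shows "induced_map (P 1) \<phi>12 (induced_map (P 3) \<phi>31 (induced_map (P 2) \<phi>23 \<omega>)) = \<omega>"
proof -
  have fin: "finite (Om 2)"
    by (rule finite_elements[OF finite_verts partition_on_Om]) auto
  have card: "card (Om 1) = card (Om 2)"
    using partition_Om[of 1] partition_Om[of 2] by (simp add: partition_into_def)
  have "inj_on (induced_map (P 1) \<phi>12) (Om 1)"
    by (rule inj_on_inverseI) (rule induced_identity)
  then have "induced_map (P 1) \<phi>12 ` Om 1 = Om 2"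
    using fin card induced_mem(1) by (intro card_subset_eq) (auto simp: card_image)
  then obtain \<omega>' where "\<omega>' \<in> Om 1" "\<omega> = induced_map (P 1) \<phi>12 \<omega>'" using assms by blast
  then show ?thesis using induced_identity by simp
qed

text \<open>
  Every condition except the one on the composition of the induced maps is visibly symmetric. Together
  with \<open>Gamma_bar_rotate\<close> this transports any fact about position 1 to positions 2 and 3.
\<close>

lemma rotate:
  "construction_data lam mu (\<lambda>i. \<Gamma> (rot i)) (\<lambda>i. Om (rot i)) (\<lambda>i. P (rot i)) (\<lambda>i. P' (rot i))
     \<phi>23 \<phi>31 \<phi>12"
proof (unfold_locales, unfold rot_simps)
  show "disjoint_family_on (\<lambda>i. pverts (\<Gamma> (rot i))) {1, 2, 3}"
    using disjoint_verts by (auto simp: disjoint_family_on_def rot_def)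
next
  show "admissible mu (Om 2) (P 2) (Om 3) (P' 3) \<phi>23" by (rule admissible_23)
  show "admissible mu (Om 3) (P 3) (Om 1) (P' 1) \<phi>31" by (rule admissible_31)
  show "admissible mu (Om 1) (P 1) (Om 2) (P' 2) \<phi>12" by (rule admissible_12)
next
  fix \<omega> assume "\<omega> \<in> Om 2"
  then show "induced_map (P 1) \<phi>12 (induced_map (P 3) \<phi>31 (induced_map (P 2) \<phi>23 \<omega>)) = \<omega>"
    by (rule induced_identity_rotated)
qed (fact edge_regular[OF rot_mem] partition_Om[OF rot_mem] partition_P[OF rot_mem]
       partition_P'[OF rot_mem] independent_P[OF rot_mem] independent_P'[OF rot_mem]
       union_P[OF rot_mem] union_P'[OF rot_mem] card_inter[OF rot_mem])+

lemma Gamma_bar_rotate: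
  "Gamma_bar (\<lambda>i. \<Gamma> (rot i)) (\<lambda>i. P (rot i)) \<phi>23 \<phi>31 \<phi>12 = \<Gamma>bar"
  by (auto simp: Gamma_bar_def Let_def rot_def)

section \<open>Neighbourhoods in the glued graph\<close>

lemma neighbours_V1:
  assumes x: "x \<in> pverts (\<Gamma> 1)"
  shows "neighbours \<Gamma>bar x = neighbours (\<Gamma> 1) x \<union> \<phi>12 (part_of (P 1) x)
           \<union> inv_into (P 3) \<phi>31 (part_of (P' 1) x)"
proof -
  interpret G1: pair_graph "\<Gamma> 1" by (rule pair_graph_\<Gamma>) simp
  interpret G2: pair_graph "\<Gamma> 2" by (rule pair_graph_\<Gamma>) simp
  interpret G3: pair_graph "\<Gamma> 3" by (rule pair_graph_\<Gamma>) simp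
  have sub: "\<phi>12 (part_of (P 1) x) \<subseteq> pverts (\<Gamma> 2)"
    using bij_\<phi>(1) part_of_mem(1)[OF partition_on_P x] partition_on_P'[of 2]
    by (auto simp: bij_betw_def partition_on_def)
  have inv: "z \<in> inv_into (P 3) \<phi>31 (part_of (P' 1) x) \<longleftrightarrow>
      z \<in> pverts (\<Gamma> 3) \<and> x \<in> \<phi>31 (part_of (P 3) z)" for z
    using mem_image_part_of_iff[OF partition_on_P partition_on_P' bij_\<phi>(3) x] by simp
  have notin: "x \<notin> pverts (\<Gamma> 2)" "x \<notin> pverts (\<Gamma> 3)" using x disjoint_verts by auto
  have arc: "(x, z) \<in> parcs \<Gamma>bar \<longleftrightarrow> (x, z) \<in> parcs (\<Gamma> 1) \<or> z \<in> \<phi>12 (part_of (P 1) x)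
      \<or> z \<in> inv_into (P 3) \<phi>31 (part_of (P' 1) x)" for z
    using x notin sub G2.wellformed' G3.wellformed'
    by (auto simp: inv Gamma_bar_def Let_def cross_arcs_def simp del: One_nat_def)
  interpret G: pair_graph \<Gamma>bar by (rule pair_graph_Gamma_bar)
  have "neighbours \<Gamma>bar x = {z. (x, z) \<in> parcs \<Gamma>bar}"
    using G.wellformed' by (auto simp: neighbours_def)
  moreover have "neighbours (\<Gamma> 1) x = {z. (x, z) \<in> parcs (\<Gamma> 1)}"
    using G1.wellformed' by (auto simp: neighbours_def)
  ultimately show ?thesis unfolding arc by blast
qed

lemma neighbours_V2:
  assumes "x \<in> pverts (\<Gamma> 2)"
  shows "neighbours \<Gamma>bar x = neighbours (\<Gamma> 2) x \<union> \<phi>23 (part_of (P 2) x)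
           \<union> inv_into (P 1) \<phi>12 (part_of (P' 2) x)"
  using construction_data.neighbours_V1[OF rotate] assms
  unfolding rot_simps Gamma_bar_rotate by blast

lemma neighbours_V3:
  assumes "x \<in> pverts (\<Gamma> 3)"
  shows "neighbours \<Gamma>bar x = neighbours (\<Gamma> 3) x \<union> \<phi>31 (part_of (P 3) x)
           \<union> inv_into (P 2) \<phi>23 (part_of (P' 3) x)"
  using construction_data.neighbours_V2[OF rotate] assms
  unfolding rot_simps Gamma_bar_rotate by blast

lemma image_cell:
  assumes "x \<in> pverts (\<Gamma> 1)"
  shows "part_of (P 1) x \<in> P 1" "\<phi>12 (part_of (P 1) x) \<in> P' 2"
    "\<phi>12 (part_of (P 1) x) \<subseteq> pverts (\<Gamma> 2)"
proof -
  show "part_of (P 1) x \<in> P 1" using part_of_mem(1)[OF partition_on_P assms] by simp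
  then show "\<phi>12 (part_of (P 1) x) \<in> P' 2" using bij_\<phi>(1) by (auto simp: bij_betw_def)
  then show "\<phi>12 (part_of (P 1) x) \<subseteq> pverts (\<Gamma> 2)"
    using partition_on_P'[of 2] by (auto simp: partition_on_def)
qed

lemma preimage_cell:
  assumes "x \<in> pverts (\<Gamma> 1)"
  shows "part_of (P' 1) x \<in> P' 1" "inv_into (P 3) \<phi>31 (part_of (P' 1) x) \<in> P 3"
    "\<phi>31 (inv_into (P 3) \<phi>31 (part_of (P' 1) x)) = part_of (P' 1) x"
    "inv_into (P 3) \<phi>31 (part_of (P' 1) x) \<subseteq> pverts (\<Gamma> 3)"
proof -
  show 1: "part_of (P' 1) x \<in> P' 1" using part_of_mem(1)[OF partition_on_P' assms] by simp
  then show 2: "inv_into (P 3) \<phi>31 (part_of (P' 1) x) \<in> P 3"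
    using bij_\<phi>(3) by (metis bij_betw_def inv_into_into)
  show "\<phi>31 (inv_into (P 3) \<phi>31 (part_of (P' 1) x)) = part_of (P' 1) x"
    using bij_\<phi>(3) 1 by (metis bij_betw_def f_inv_into_f)
  show "inv_into (P 3) \<phi>31 (part_of (P' 1) x) \<subseteq> pverts (\<Gamma> 3)"
    using 2 partition_on_P[of 3] by (auto simp: partition_on_def)
qed

lemma neighbours_within: "neighbours (\<Gamma> i) x \<subseteq> pverts (\<Gamma> i)"
  by (auto simp: neighbours_def)

section \<open>Degrees and common neighbours\<close>

lemma degree_V1:
  assumes x: "x \<in> pverts (\<Gamma> 1)"
  shows "card (neighbours \<Gamma>bar x) = (3 * mu + 1) * lam"
proof -
  let ?A = "neighbours (\<Gamma> 1) x" and ?B = "\<phi>12 (part_of (P 1) x)"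
    and ?C = "inv_into (P 3) \<phi>31 (part_of (P' 1) x)"
  note sub = neighbours_within[of 1 x] image_cell(3)[OF x] preimage_cell(4)[OF x]
  have fin: "finite ?A" "finite ?B" "finite ?C"
    using sub finite_verts finite_subset by blast+
  have "card ?A = lam * (mu + 1)"
    using edge_regular[of 1] x by (simp add: edge_regular_def regular_graph_def)
  moreover have "card ?B = mu * lam"
    using image_cell(2)[OF x] partition_P'[of 2] by (simp add: partition_into_def)
  moreover have "card ?C = mu * lam"
    using preimage_cell(2)[OF x] partition_P[of 3] by (simp add: partition_into_def)
  moreover have "?A \<inter> ?B = {}" "(?A \<union> ?B) \<inter> ?C = {}" using sub disjoint_verts by blast+
  then have "card (?A \<union> ?B \<union> ?C) = card ?A + card ?B + card ?C"
    using fin by (simp add: card_Un_disjoint)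
  ultimately show ?thesis unfolding neighbours_V1[OF x] by (simp add: algebra_simps)
qed

text \<open>
  The cells attached to \<open>x\<close> and to \<open>y\<close> come from different cells, since each cell is independent, and
  are therefore disjoint; the common neighbours are the old ones.
\<close>

lemma common_neighbours_inside_V1:
  assumes xy: "(x, y) \<in> parcs (\<Gamma> 1)"
  shows "card (neighbours \<Gamma>bar x \<inter> neighbours \<Gamma>bar y) = lam"
proof -
  interpret G1: pair_graph "\<Gamma> 1" by (rule pair_graph_\<Gamma>) simp
  have x: "x \<in> pverts (\<Gamma> 1)" and y: "y \<in> pverts (\<Gamma> 1)" using G1.wellformed'[OF xy] by auto
  have separated: "part_of Q x \<noteq> part_of Q y"
    if "partition_on (pverts (\<Gamma> 1)) Q" "\<And>X. X \<in> Q \<Longrightarrow> independent_set (\<Gamma> 1) X" for Q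
  proof
    assume "part_of Q x = part_of Q y"
    moreover note part_of_mem[OF that(1) x] part_of_mem[OF that(1) y]
    ultimately show False using that(2) xy unfolding independent_set_def by metis
  qed
  have "part_of (P 1) x \<noteq> part_of (P 1) y"
    by (rule separated[OF partition_on_P independent_P]) auto
  then have "\<phi>12 (part_of (P 1) x) \<noteq> \<phi>12 (part_of (P 1) y)"
    using image_cell(1)[OF x] image_cell(1)[OF y] bij_\<phi>(1) by (metis bij_betw_def inj_onD)
  then have 2: "\<phi>12 (part_of (P 1) x) \<inter> \<phi>12 (part_of (P 1) y) = {}"
    using image_cell(2)[OF x] image_cell(2)[OF y] cells_eqI[OF partition_on_P'[of 2]] by blast
  have "part_of (P' 1) x \<noteq> part_of (P' 1) y"
    by (rule separated[OF partition_on_P' independent_P']) auto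
  then have "inv_into (P 3) \<phi>31 (part_of (P' 1) x) \<noteq> inv_into (P 3) \<phi>31 (part_of (P' 1) y)"
    using preimage_cell(3)[OF x] preimage_cell(3)[OF y] by metis
  then have 3: "inv_into (P 3) \<phi>31 (part_of (P' 1) x) \<inter> inv_into (P 3) \<phi>31 (part_of (P' 1) y) = {}"
    using preimage_cell(2)[OF x] preimage_cell(2)[OF y] cells_eqI[OF partition_on_P[of 3]]
    by blast
  have "neighbours \<Gamma>bar x \<inter> neighbours \<Gamma>bar y = neighbours (\<Gamma> 1) x \<inter> neighbours (\<Gamma> 1) y"
    unfolding neighbours_V1[OF x] neighbours_V1[OF y]
    using 2 3 neighbours_within[of 1] image_cell(3)[OF x] image_cell(3)[OF y]
      preimage_cell(4)[OF x] preimage_cell(4)[OF y] disjoint_verts by blast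
  then show ?thesis using edge_regular[of 1] xy by (auto simp: edge_regular_def)
qed

text \<open>
  The common neighbours are the points of \<open>Z \<inter> Y\<close>, where \<open>Z\<close> is the \<open>P 3\<close>-cell attached to \<open>x\<close> and
  \<open>Y\<close> the \<open>P' 3\<close>-cell attached to \<open>y\<close>. The identity condition on the induced maps enters here: it
  places \<open>Y\<close> and \<open>Z\<close> in the same block of \<open>Om 3\<close>.
\<close>

lemma common_neighbours_across_12:
  assumes x: "x \<in> pverts (\<Gamma> 1)" and yx: "y \<in> \<phi>12 (part_of (P 1) x)"
  shows "card (neighbours \<Gamma>bar x \<inter> neighbours \<Gamma>bar y) = lam"
proof -
  have y: "y \<in> pverts (\<Gamma> 2)" using image_cell(3)[OF x] yx by auto
  define Z where "Z = inv_into (P 3) \<phi>31 (part_of (P' 1) x)"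
  define Y where "Y = \<phi>23 (part_of (P 2) y)"
  have py: "part_of (P' 2) y = \<phi>12 (part_of (P 1) x)"
    by (rule part_of_eqI[OF partition_on_P' image_cell(2)[OF x] yx]) simp
  have pre_y: "inv_into (P 1) \<phi>12 (part_of (P' 2) y) = part_of (P 1) x"
    unfolding py using bij_\<phi>(1) image_cell(1)[OF x] by (simp add: bij_betw_def)
  have Py: "part_of (P 2) y \<in> P 2" "y \<in> part_of (P 2) y"
    using part_of_mem[OF partition_on_P y] by auto
  have Y: "Y \<in> P' 3" using Py bij_\<phi>(2) by (auto simp: Y_def bij_betw_def)
  then have Y_sub: "Y \<subseteq> pverts (\<Gamma> 3)" using partition_on_P'[of 3] by (auto simp: partition_on_def)
  have Px: "x \<in> part_of (P 1) x" "part_of (P 1) x \<subseteq> pverts (\<Gamma> 1)"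
    using part_of_mem[OF partition_on_P x] partition_on_P[of 1] by (auto simp: partition_on_def)
  have no1: "neighbours (\<Gamma> 1) x \<inter> part_of (P 1) x = {}"
    using independent_P[OF _ image_cell(1)[OF x]] Px
    by (auto simp: independent_set_def neighbours_def)
  have no2: "\<phi>12 (part_of (P 1) x) \<inter> neighbours (\<Gamma> 2) y = {}"
    using independent_P'[OF _ image_cell(2)[OF x]] yx
    by (auto simp: independent_set_def neighbours_def)
  have "neighbours \<Gamma>bar x \<inter> neighbours \<Gamma>bar y = Z \<inter> Y"
    unfolding neighbours_V1[OF x] neighbours_V2[OF y] pre_y Z_def[symmetric] Y_def[symmetric]
    using no1 no2 Y_sub Px neighbours_within[of 1] neighbours_within[of 2] image_cell(3)[OF x]
      preimage_cell(4)[OF x, folded Z_def] disjoint_verts by blast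
  moreover have "card (Z \<inter> Y) = lam"
  proof -
    \<comment> \<open>The block of \<open>x\<close> carried forward twice contains \<open>Y\<close>. Carried forward a third time it is the
      block of \<open>x\<close> again, which contains the \<open>P' 1\<close>-cell of \<open>x\<close>; so \<open>Z\<close>, the preimage of that cell,
      lies in \<open>\<omega>3\<close>.\<close>
    define \<omega>1 where "\<omega>1 = part_of (Om 1) x"
    define \<omega>2 where "\<omega>2 = induced_map (P 1) \<phi>12 \<omega>1"
    define \<omega>3 where "\<omega>3 = induced_map (P 2) \<phi>23 \<omega>2"
    have \<omega>1: "\<omega>1 \<in> Om 1" "x \<in> \<omega>1"
      using part_of_mem[OF partition_on_Om x] by (auto simp: \<omega>1_def)
    have \<omega>2: "\<omega>2 \<in> Om 2" using induced_mem(1)[OF \<omega>1(1)] by (simp add: \<omega>2_def)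
    have \<omega>3: "\<omega>3 \<in> Om 3" using induced_mem(2)[OF \<omega>2] by (simp add: \<omega>3_def)
    have \<omega>1_eq: "induced_map (P 3) \<phi>31 \<omega>3 = \<omega>1"
      unfolding \<omega>3_def \<omega>2_def by (rule induced_identity[OF \<omega>1(1)])
    have "part_of (P 1) x \<subseteq> \<omega>1"
      by (rule cell_subset_union_of_cells[OF partition_on_P union_P[OF _ \<omega>1(1)]
            image_cell(1)[OF x] Px(1) \<omega>1(2)]) auto
    then have "\<phi>12 (part_of (P 1) x) \<subseteq> \<omega>2"
      unfolding \<omega>2_def
      using image_cell_subset_induced_map_iff[OF partition_on_P' bij_\<phi>(1) image_cell(1)[OF x]]
      by simp
    then have "y \<in> \<omega>2" using yx by auto
    have "part_of (P 2) y \<subseteq> \<omega>2"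
      by (rule cell_subset_union_of_cells[OF partition_on_P union_P[OF _ \<omega>2] Py \<open>y \<in> \<omega>2\<close>]) auto
    then have Y3: "Y \<subseteq> \<omega>3"
      unfolding \<omega>3_def Y_def
      using image_cell_subset_induced_map_iff[OF partition_on_P' bij_\<phi>(2) Py(1)] by simp
    have "part_of (P' 1) x \<subseteq> \<omega>1"
      by (rule cell_subset_union_of_cells[OF partition_on_P' union_P'[OF _ \<omega>1(1)]
            part_of_mem[OF partition_on_P' x] \<omega>1(2)]) auto
    then have "\<phi>31 Z \<subseteq> induced_map (P 3) \<phi>31 \<omega>3"
      unfolding \<omega>1_eq Z_def preimage_cell(3)[OF x] .
    then have "Z \<subseteq> \<omega>3"
      using image_cell_subset_induced_map_iff[OF partition_on_P' bij_\<phi>(3) preimage_cell(2)[OF x]]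
      by (simp add: Z_def)
    then show ?thesis
      using card_inter[OF _ \<omega>3 _ Y _ Y3] preimage_cell(2)[OF x] by (simp add: Z_def)
  qed
  ultimately show ?thesis by simp
qed

lemma verts_Gamma_bar: "pverts \<Gamma>bar = pverts (\<Gamma> 1) \<union> pverts (\<Gamma> 2) \<union> pverts (\<Gamma> 3)"
  by (auto simp: Gamma_bar_def Let_def)

lemma card_verts: "card (pverts \<Gamma>bar) = 3 * mu * lam * (lam + 2)"
proof -
  have "card (pverts (\<Gamma> i)) = mu * lam * (lam + 2)" if "i \<in> {1, 2, 3}" for i
    using edge_regular[OF that] by (simp add: edge_regular_def)
  then have "card (pverts (\<Gamma> 1)) = mu * lam * (lam + 2)" "card (pverts (\<Gamma> 2)) = mu * lam * (lam + 2)"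
    "card (pverts (\<Gamma> 3)) = mu * lam * (lam + 2)" by blast+
  moreover have "(pverts (\<Gamma> 1) \<union> pverts (\<Gamma> 2)) \<inter> pverts (\<Gamma> 3) = {}" using disjoint_verts by blast
  then have "card (pverts \<Gamma>bar) = card (pverts (\<Gamma> 1)) + card (pverts (\<Gamma> 2)) + card (pverts (\<Gamma> 3))"
    unfolding verts_Gamma_bar using finite_verts disjoint_verts
    by (subst card_Un_disjoint; simp add: card_Un_disjoint)
  ultimately show ?thesis by simp
qed

lemma degree:
  assumes "x \<in> pverts \<Gamma>bar"
  shows "card (neighbours \<Gamma>bar x) = (3 * mu + 1) * lam"
proof -
  interpret R: construction_data lam mu "\<lambda>i. \<Gamma> (rot i)" "\<lambda>i. Om (rot i)" "\<lambda>i. P (rot i)"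
    "\<lambda>i. P' (rot i)" \<phi>23 \<phi>31 \<phi>12 by (rule rotate)
  note R2 = construction_data.degree_V1[OF R.rotate]
  show ?thesis
    using assms degree_V1 R.degree_V1 R2
    unfolding verts_Gamma_bar rot_simps R.Gamma_bar_rotate Gamma_bar_rotate by blast
qed

lemma common_neighbours:
  assumes "(x, y) \<in> parcs \<Gamma>bar"
  shows "card (neighbours \<Gamma>bar x \<inter> neighbours \<Gamma>bar y) = lam"
proof -
  interpret R: construction_data lam mu "\<lambda>i. \<Gamma> (rot i)" "\<lambda>i. Om (rot i)" "\<lambda>i. P (rot i)"
    "\<lambda>i. P' (rot i)" \<phi>23 \<phi>31 \<phi>12 by (rule rotate)
  note rots = rot_simps R.Gamma_bar_rotate Gamma_bar_rotate
  note inside = common_neighbours_inside_V1 R.common_neighbours_inside_V1[unfolded rots]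
    construction_data.common_neighbours_inside_V1[OF R.rotate, unfolded rots]
  note across = common_neighbours_across_12 R.common_neighbours_across_12[unfolded rots]
    construction_data.common_neighbours_across_12[OF R.rotate, unfolded rots]
  have across': "card (neighbours \<Gamma>bar u \<inter> neighbours \<Gamma>bar v) = lam"
    if "(u, v) \<in> cross_arcs (\<Gamma> 1) (P 1) (\<Gamma> 2) \<phi>12 \<union> cross_arcs (\<Gamma> 2) (P 2) (\<Gamma> 3) \<phi>23
          \<union> cross_arcs (\<Gamma> 3) (P 3) (\<Gamma> 1) \<phi>31" for u v
    using that across unfolding cross_arcs_def by blast
  let ?A = "cross_arcs (\<Gamma> 1) (P 1) (\<Gamma> 2) \<phi>12 \<union> cross_arcs (\<Gamma> 2) (P 2) (\<Gamma> 3) \<phi>23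
          \<union> cross_arcs (\<Gamma> 3) (P 3) (\<Gamma> 1) \<phi>31"
  have "(x, y) \<in> parcs (\<Gamma> 1) \<or> (x, y) \<in> parcs (\<Gamma> 2) \<or> (x, y) \<in> parcs (\<Gamma> 3)
      \<or> (x, y) \<in> ?A \<or> (y, x) \<in> ?A"
    using assms unfolding Gamma_bar_def Let_def by auto
  then show ?thesis
    using inside across'[of x y] across'[of y x] by (metis Int_commute)
qed

section \<open>Regular cliques\<close>

text \<open>
  A vertex of \<open>V\<^sub>2\<close> sees in \<open>V\<^sub>1\<close> exactly one cell of \<open>P 1\<close>, a vertex of \<open>V\<^sub>3\<close> exactly one cell of
  \<open>P' 1\<close>, and \<open>C\<close> is a transversal of both partitions. A vertex of \<open>V\<^sub>1\<close> sees in \<open>V\<^sub>1\<close> only its old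
  neighbours, so the count within \<open>\<Gamma> 1\<close> applies.
\<close>

lemma nexus_one_V1:
  assumes dvd: "mu dvd lam + 2" and C: "clique (\<Gamma> 1) C" "card C = lam + 2"
    and w: "w \<in> pverts \<Gamma>bar - C"
  shows "card (neighbours \<Gamma>bar w \<inter> C) = 1"
proof -
  have CV: "C \<subseteq> pverts (\<Gamma> 1)" using C by (simp add: clique_def)
  \<comment> \<open>Divisibility makes the number of cells equal to the size of the clique.\<close>
  have cells: "mu * ((lam + 2) div mu) = lam + 2" using dvd by simp
  have trans: "card (X \<inter> C) = 1" if "X \<in> P 1" for X
    using that partition_P[of 1] C cells independent_P
    by (intro clique_transversal[OF partition_on_P finite_elements[OF finite_verts partition_on_P]])
      (auto simp: partition_into_def)
  have trans': "card (X \<inter> C) = 1" if "X \<in> P' 1" for X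
    using that partition_P'[of 1] C cells independent_P'
    by (intro clique_transversal[OF partition_on_P' finite_elements[OF finite_verts partition_on_P']])
      (auto simp: partition_into_def)
  consider "w \<in> pverts (\<Gamma> 1)" | "w \<in> pverts (\<Gamma> 2)" | "w \<in> pverts (\<Gamma> 3)"
    using w unfolding verts_Gamma_bar by blast
  then show ?thesis
  proof cases
    case 1
    have "neighbours \<Gamma>bar w \<inter> C = neighbours (\<Gamma> 1) w \<inter> C"
      unfolding neighbours_V1[OF 1]
      using CV image_cell(3)[OF 1] preimage_cell(4)[OF 1] disjoint_verts by blast
    moreover have "mu * lam * (lam + 2) = (lam + 2) * (lam * (mu + 1) - lam)"
      by (simp add: algebra_simps)
    then have "card (neighbours (\<Gamma> 1) w \<inter> C) = 1"
      using 1 w by (intro clique_nexus_one[OF edge_regular _ C]) auto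
    ultimately show ?thesis by simp
  next
    case 2
    let ?X = "inv_into (P 1) \<phi>12 (part_of (P' 2) w)"
    have "?X \<in> P 1"
      using part_of_mem(1)[OF partition_on_P' 2] bij_\<phi>(1)
      by (simp add: bij_betw_def inv_into_into)
    moreover have "\<phi>23 (part_of (P 2) w) \<subseteq> pverts (\<Gamma> 3)"
      using part_of_mem(1)[OF partition_on_P 2] bij_\<phi>(2) partition_on_P'[of 3]
      by (auto simp: bij_betw_def partition_on_def)
    then have "neighbours \<Gamma>bar w \<inter> C = ?X \<inter> C"
      unfolding neighbours_V2[OF 2] using CV neighbours_within[of 2] disjoint_verts by blast
    ultimately show ?thesis using trans by simp
  next
    case 3
    let ?X = "\<phi>31 (part_of (P 3) w)"
    have "?X \<in> P' 1"
      using part_of_mem(1)[OF partition_on_P 3] bij_\<phi>(3) by (auto simp: bij_betw_def)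
    moreover have "inv_into (P 2) \<phi>23 (part_of (P' 3) w) \<subseteq> pverts (\<Gamma> 2)"
      using part_of_mem(1)[OF partition_on_P' 3] bij_\<phi>(2) partition_on_P[of 2]
      by (metis (no_types, lifting) Union_upper bij_betw_def insertCI inv_into_into partition_onD1)
    then have "neighbours \<Gamma>bar w \<inter> C = ?X \<inter> C"
      unfolding neighbours_V3[OF 3] using CV neighbours_within[of 3] disjoint_verts by blast
    ultimately show ?thesis using trans' by simp
  qed
qed

lemma nexus_one:
  assumes dvd: "mu dvd lam + 2" and i: "i \<in> {1, 2, 3}"
    and C: "clique (\<Gamma> i) C" "card C = lam + 2" and w: "w \<in> pverts \<Gamma>bar - C"
  shows "card (neighbours \<Gamma>bar w \<inter> C) = 1"
proof -
  interpret R: construction_data lam mu "\<lambda>i. \<Gamma> (rot i)" "\<lambda>i. Om (rot i)" "\<lambda>i. P (rot i)"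
    "\<lambda>i. P' (rot i)" \<phi>23 \<phi>31 \<phi>12 by (rule rotate)
  note rots = rot_simps R.Gamma_bar_rotate Gamma_bar_rotate
  show ?thesis
    using i C w nexus_one_V1[OF dvd] R.nexus_one_V1[OF dvd, unfolded rots]
      construction_data.nexus_one_V1[OF R.rotate dvd, unfolded rots]
    by blast
qed

lemma edge_regular_Gamma_bar:
  "edge_regular \<Gamma>bar (3 * mu * lam * (lam + 2)) ((3 * mu + 1) * lam) lam"
proof -
  have "2 \<le> mu * lam * (lam + 2)" using edge_regular[of 1] by (simp add: edge_regular_def)
  \<comment> \<open>Needed for positive degree; it follows from the graphs having at least two vertices.\<close>
  moreover from this have "lam > 0" by (cases lam) auto
  ultimately show ?thesis
    using pair_graph_Gamma_bar card_verts degree common_neighbours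
    by (auto simp: edge_regular_def regular_graph_def simp del: mult_Suc_right add_2_eq_Suc')
qed

lemma regular_clique_Gamma_bar:
  assumes "mu dvd lam + 2" "i \<in> {1, 2, 3}" "clique (\<Gamma> i) C" "card C = lam + 2"
  shows "regular_clique \<Gamma>bar C 1"
proof -
  have "clique \<Gamma>bar C"
    using assms(2,3) by (auto simp: clique_def Gamma_bar_def Let_def)
  moreover have "C \<noteq> {}" using assms(4) by auto
  ultimately show ?thesis
    using nexus_one[OF assms] edge_regular_Gamma_bar
    by (auto simp: regular_clique_def edge_regular_def)
qed

end

section \<open>The glued graph is a Neumaier graph\<close>

theorem theorem2p1:
  fixes lam mu :: nat
    and \<Gamma> :: "nat \<Rightarrow> 'a pair_pre_digraph"
    and Om P P' :: "nat \<Rightarrow> 'a set set"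
    and \<phi>12 \<phi>23 \<phi>31 :: "'a set \<Rightarrow> 'a set"
    and G :: "'a pair_pre_digraph"
  assumes "lam > 0" and "mu > 0" and "mu dvd lam + 2"
    and "construction_data lam mu \<Gamma> Om P P' \<phi>12 \<phi>23 \<phi>31"
    and "G = Gamma_bar \<Gamma> P \<phi>12 \<phi>23 \<phi>31"
  shows "card (pverts G) = 3 * mu * lam * (lam + 2) \<and>
    (\<forall>v\<in>pverts G. card (neighbours G v) = (3 * mu + 1) * lam) \<and>
    (\<forall>(x, y)\<in>parcs G. card (neighbours G x \<inter> neighbours G y) = lam) \<and>
    (\<forall>i\<in>{1, 2, 3}. \<forall>C. clique (\<Gamma> i) C \<and> card C = lam + 2 \<longrightarrow>
       regular_clique G C 1 \<and> card C = lam + 2 \<and>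
       neumaier_graph G (3 * mu * lam * (lam + 2)) ((3 * mu + 1) * lam) lam 1 (lam + 2))"
proof -
  interpret construction_data lam mu \<Gamma> Om P P' \<phi>12 \<phi>23 \<phi>31 by fact
  have rc: "regular_clique G C 1" if "i \<in> {1, 2, 3}" "clique (\<Gamma> i) C" "card C = lam + 2" for i C
    unfolding assms(5) using assms(3) that by (rule regular_clique_Gamma_bar)
  have ng: "neumaier_graph G (3 * mu * lam * (lam + 2)) ((3 * mu + 1) * lam) lam 1 (lam + 2)"
    if "i \<in> {1, 2, 3}" "clique (\<Gamma> i) C" "card C = lam + 2" for i C
    unfolding neumaier_graph_def
  proof (intro conjI exI)
    show "edge_regular G (3 * mu * lam * (lam + 2)) ((3 * mu + 1) * lam) lam"
      unfolding assms(5) by (rule edge_regular_Gamma_bar)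
  qed (fact rc[OF that] that(3))+
  show ?thesis
  proof (intro conjI ballI allI impI)
    show "card (pverts G) = 3 * mu * lam * (lam + 2)"
      unfolding assms(5) by (rule card_verts)
  next
    fix v assume "v \<in> pverts G"
    then show "card (neighbours G v) = (3 * mu + 1) * lam"
      unfolding assms(5) by (rule degree)
  next
    fix e assume "e \<in> parcs G"
    then show "case e of (x, y) \<Rightarrow> card (neighbours G x \<inter> neighbours G y) = lam"
      unfolding assms(5) by (cases e) (simp add: common_neighbours)
  next
    fix i C assume "i \<in> {1, 2, 3}" and C: "clique (\<Gamma> i) C \<and> card C = lam + 2"
    then show "regular_clique G C 1"
      and "neumaier_graph G (3 * mu * lam * (lam + 2)) ((3 * mu + 1) * lam) lam 1 (lam + 2)"
      by (blast intro: rc ng)+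
    show "card C = lam + 2" using C ..
  qed
qed

end
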